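(* Let $\mathbb{X},\mathbb{Y}$ be normed linear spaces over the same field $\mathbb{K}\in\{\mathbb{R},\mathbb{C}\}$ and let $F$ be a face of $B_{\mathbb{X}}$. If there exists a nonzero level number for a bounded linear operator $T:\mathbb{X}\to\mathbb{Y}$ corresponding to a level vector $u\in\mathrm{Int}_r\,F$, then $Tv\neq0$ for all $v\in F$.
   Context: A semi-inner product on a normed space $\mathbb{X}$ over $\mathbb{K}$ is a function $[\cdot,\cdot]:\mathbb{X}\times\mathbb{X}\to\mathbb{K}$ such that for all $\alpha,\beta\in\mathbb{K}$, $x,y,z\in\mathbb{X}$: (1) $[\alpha x+\beta y,z]=\alpha[x,z]+\beta[y,z]$; (2) $[x,x]>0$ whenever $x\neq0$; (3) $|[x,y]|^2\le[x,x][y,y]$; (4) $[x,\alpha y]=\overline{\alpha}[x,y]$. All semi-inner products on a normed space are assumed compatible with the norm: $\|x\|=[x,x]^{1/2}$ for all $x$. For a bounded linear operator $T:\mathbb{X}\to\mathbb{Y}$, a scalar $k$ is a level number of $T$ corresponding to a level vector $x$ ($x\in\mathbb{X}$ nonzero) if there exist semi-inner products $[\cdot,\cdot]_{\mathbb{X}}$ on $\mathbb{X}$ and $[\cdot,\cdot]_{\mathbb{Y}}$ on $\mathbb{Y}$ with $[Ty,Tx]_{\mathbb{Y}}=k[y,x]_{\mathbb{X}}$ for all $y\in\mathbb{X}$. $B_{\mathbb{X}}$ and $S_{\mathbb{X}}$ are the closed unit ball and unit sphere. A convex set $F\subset S_{\mathbb{X}}$ is a face of $B_{\mathbb{X}}$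 if for any $u,v\in S_{\mathbb{X}}$ and $0<t<1$, $(1-t)u+tv\in F$ implies $u,v\in F$. For nonempty $D\subset\mathbb{X}$, $\mathrm{aff}(D)$ is the intersection of all affine spaces (translates of subspaces of $\mathbb{X}$) containing $D$, and $\mathrm{Int}_r\,D=\{x\in D:\exists\,\epsilon>0,\ B(x,\epsilon)\cap\mathrm{aff}(D)\subseteq D\}$. *)

theory Defs
  imports "HOL-Analysis.Analysis" "HOL-Library.Complex_Order"
begin

text \<open>
  The scalar field: \<open>\<real>\<close> or \<open>\<complex>\<close>. By the Gelfand--Mazur theorem a real normed field is
  isometrically isomorphic to \<open>\<real>\<close> or \<open>\<complex>\<close>, and the axioms below force the usual conjugation
  and the order of \<^theory>\<open>HOL-Library.Complex_Order\<close> (\<open>x \<le> y\<close> iff \<open>y - x\<close> is a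
  nonnegative real). So quantifying over this class is quantifying over \<open>\<real>\<close> and \<open>\<complex>\<close>, the two
  instances given below.
\<close>

class real_or_complex = real_normed_field + order +
  fixes conjg :: "'a \<Rightarrow> 'a"
  assumes conjg_add: "conjg (x + y) = conjg x + conjg y"
    and mult_conjg: "x * conjg x = (norm x)\<^sup>2 *\<^sub>R 1"
    and le_iff_diff_scaleR: "x \<le> y \<longleftrightarrow> (\<exists>r\<ge>0. y - x = r *\<^sub>R 1)"

instantiation real :: real_or_complex
begin

definition conjg_real :: "real \<Rightarrow> real" where
  "conjg_real x = x"

instance
proof
  fix x y :: real
  show "conjg (x + y) = conjg x + conjg y"
    by (simp add: conjg_real_def)
  show "x * conjg x = (norm x)\<^sup>2 *\<^sub>R 1"
    by (simp add: conjg_real_def power2_eq_square)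
  show "x \<le> y \<longleftrightarrow> (\<exists>r\<ge>0. y - x = r *\<^sub>R 1)"
    by (auto intro: exI[of _ "y - x"])
qed

end

instantiation complex :: real_or_complex
begin

definition conjg_complex :: "complex \<Rightarrow> complex" where
  "conjg_complex = cnj"

instance
proof
  fix x y :: complex
  show "conjg (x + y) = conjg x + conjg y"
    by (simp add: conjg_complex_def)
  show "x * conjg x = (norm x)\<^sup>2 *\<^sub>R 1"
    unfolding conjg_complex_def complex_norm_square [symmetric] by (simp add: of_real_def)
  show "x \<le> y \<longleftrightarrow> (\<exists>r\<ge>0. y - x = r *\<^sub>R 1)"
  proof
    assume "x \<le> y"
    then show "\<exists>r\<ge>0. y - x = r *\<^sub>R 1"
      by (intro exI[of _ "Re y - Re x"]) (auto simp: less_eq_complex_def complex_eq_iff)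
  qed (auto simp: less_eq_complex_def complex_eq_iff)
qed

end

text \<open>
  A normed space over \<open>'k\<close>: a real normed space whose real scalar multiplication is the
  restriction of \<open>smul\<close>. For \<open>'k = real\<close>, \<open>smul\<close> is the scalar multiplication of the type.
\<close>

locale normed_space_over = vector_space smul
  for smul :: "'k::real_or_complex \<Rightarrow> 'x::real_normed_vector \<Rightarrow> 'x" +
  assumes smul_of_real: "smul (of_real r) x = r *\<^sub>R x"
    and norm_smul: "norm (smul a x) = norm a * norm x"

definition bounded_operator ::
  "('k::real_or_complex \<Rightarrow> 'x::real_normed_vector \<Rightarrow> 'x) \<Rightarrow>
   ('k \<Rightarrow> 'y::real_normed_vector \<Rightarrow> 'y) \<Rightarrow> ('x \<Rightarrow> 'y) \<Rightarrow> bool" where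
  "bounded_operator smulX smulY T \<longleftrightarrow>
     Vector_Spaces.linear smulX smulY T \<and> (\<exists>C. \<forall>x. norm (T x) \<le> C * norm x)"

text \<open>
  The last conjunct is compatibility with the norm, which is part of the definition here.
\<close>

definition semi_inner_product ::
  "('k::real_or_complex \<Rightarrow> 'x::real_normed_vector \<Rightarrow> 'x) \<Rightarrow> ('x \<Rightarrow> 'x \<Rightarrow> 'k) \<Rightarrow> bool" where
  "semi_inner_product smul ip \<longleftrightarrow>
     (\<forall>\<alpha> \<beta> x y z. ip (smul \<alpha> x + smul \<beta> y) z = \<alpha> * ip x z + \<beta> * ip y z) \<and>
     (\<forall>x. x \<noteq> 0 \<longrightarrow> ip x x > 0) \<and>
     (\<forall>x y. of_real ((norm (ip x y))\<^sup>2) \<le> ip x x * ip y y) \<and>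
     (\<forall>\<alpha> x y. ip x (smul \<alpha> y) = conjg \<alpha> * ip x y) \<and>
     (\<forall>x. of_real ((norm x)\<^sup>2) = ip x x)"

definition level_number ::
  "('k::real_or_complex \<Rightarrow> 'x::real_normed_vector \<Rightarrow> 'x) \<Rightarrow>
   ('k \<Rightarrow> 'y::real_normed_vector \<Rightarrow> 'y) \<Rightarrow> ('x \<Rightarrow> 'y) \<Rightarrow> 'k \<Rightarrow> 'x \<Rightarrow> bool" where
  "level_number smulX smulY T k x \<longleftrightarrow>
     x \<noteq> 0 \<and>
     (\<exists>ipX ipY. semi_inner_product smulX ipX \<and> semi_inner_product smulY ipY \<and>
        (\<forall>y. ipY (T y) (T x) = k * ipX y x))"

definition face_of_unit_ball :: "'x::real_normed_vector set \<Rightarrow> bool" where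
  "face_of_unit_ball F \<longleftrightarrow>
     convex F \<and> F \<subseteq> sphere 0 1 \<and>
     (\<forall>u\<in>sphere 0 1. \<forall>v\<in>sphere 0 1. \<forall>t::real. 0 < t \<and> t < 1 \<longrightarrow>
        (1 - t) *\<^sub>R u + t *\<^sub>R v \<in> F \<longrightarrow> u \<in> F \<and> v \<in> F)"

text \<open>
  Subspaces are taken over \<open>'k\<close>, so for \<open>'k = complex\<close> this is the complex affine hull, in
  general larger than \<^term>\<open>affine hull D\<close>, which uses real subspaces.
\<close>

definition aff ::
  "('k::real_or_complex \<Rightarrow> 'x::real_normed_vector \<Rightarrow> 'x) \<Rightarrow> 'x set \<Rightarrow> 'x set" where
  "aff smul D = \<Inter> {A. (\<exists>a V. module.subspace smul V \<and> A = (\<lambda>x. a + x) ` V) \<and> D \<subseteq> A}"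

definition rel_int ::
  "('k::real_or_complex \<Rightarrow> 'x::real_normed_vector \<Rightarrow> 'x) \<Rightarrow> 'x set \<Rightarrow> 'x set" where
  "rel_int smul D = {x \<in> D. \<exists>\<epsilon>>0. ball x \<epsilon> \<inter> aff smul D \<subseteq> D}"

end

theory Submission
  imports Defs
begin

text \<open>
  Since \<open>u\<close> is relatively interior, the segment from \<open>v \<in> F\<close> to \<open>u\<close> can be prolonged beyond \<open>u\<close>
  to a point \<open>w = (1 + e) u - e v\<close> of \<open>F\<close>, a unit vector. If \<open>T v = 0\<close>, then the level equation
  at \<open>y = v\<close> gives \<open>[v, u] = 0\<close>, so \<open>[w, u] = 1 + e\<close>, against \<open>|[w, u]| \<le> 1\<close>.
\<close>

text \<open>The Cauchy-Schwarz axiom is an inequality in the order of the scalar field; this carries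
  it back to the reals.\<close>

lemma of_real_le_of_real_iff:
  "(of_real a :: 'k::real_or_complex) \<le> of_real b \<longleftrightarrow> a \<le> b"
proof -
  have "of_real b - of_real a = r *\<^sub>R (1::'k) \<longleftrightarrow> b - a = r" for r
    unfolding of_real_def[symmetric] of_real_diff[symmetric] of_real_eq_iff ..
  then show ?thesis
    by (simp add: le_iff_diff_scaleR[where 'a = 'k])
qed

lemma semi_inner_product_self:
  "semi_inner_product smul ip \<Longrightarrow> ip x x = of_real ((norm x)\<^sup>2)"
  by (simp only: semi_inner_product_def)

lemma semi_inner_product_norm_le:
  assumes "semi_inner_product smul ip"
  shows "norm (ip x y) \<le> norm x * norm y"
proof -
  have "of_real ((norm (ip x y))\<^sup>2) \<le> ip x x * ip y y"
    using assms by (simp only: semi_inner_product_def)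
  also have "\<dots> = of_real ((norm x * norm y)\<^sup>2)"
    by (simp add: semi_inner_product_self[OF assms] power_mult_distrib)
  finally have "(norm (ip x y))\<^sup>2 \<le> (norm x * norm y)\<^sup>2"
    by (simp only: of_real_le_of_real_iff)
  then show ?thesis
    by (rule power2_le_imp_le) simp
qed

lemma (in normed_space_over) semi_inner_product_real_combination:
  assumes "semi_inner_product smul ip"
  shows "ip (a *\<^sub>R x + b *\<^sub>R y) z = of_real a * ip x z + of_real b * ip y z"
  using assms by (simp only: semi_inner_product_def smul_of_real[symmetric])

text \<open>Every translate of a subspace that contains \<open>u\<close> and \<open>v\<close>
  contains the real line through them, because real scalars act through \<open>smul\<close>, also
  over the complex field.\<close>

lemma (in normed_space_over) aff_line_mem:
  assumes "u \<in> D" and "v \<in> D"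
  shows "u + e *\<^sub>R (u - v) \<in> aff smul D"
  unfolding aff_def
proof (rule InterI, clarify)
  fix a V
  assume V: "subspace V" and D: "D \<subseteq> (+) a ` V"
  obtain p q where p: "u = a + p" "p \<in> V" and q: "v = a + q" "q \<in> V"
    using D assms by blast
  \<comment> \<open>The offset \<open>a\<close> cancels in \<open>u - v = p - q\<close>, so this is
    the prolonged point translated by \<open>-a\<close>.\<close>
  have "p + smul (of_real e) (p - q) \<in> V"
    by (intro subspace_add[OF V] subspace_scale[OF V] subspace_diff[OF V] p q)
  then show "u + e *\<^sub>R (u - v) \<in> (+) a ` V"
    by (auto simp: p(1) q(1) smul_of_real add.assoc)
qed

lemma (in normed_space_over) rel_int_prolong:
  assumes "u \<in> rel_int smul D" and "v \<in> D"
  obtains e where "e > 0" and "u + e *\<^sub>R (u - v) \<in> D"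
proof -
  obtain \<epsilon> where u: "u \<in> D" and \<epsilon>: "\<epsilon> > 0" "ball u \<epsilon> \<inter> aff smul D \<subseteq> D"
    using assms(1) by (auto simp: rel_int_def)
  \<comment> \<open>Adding 1 keeps the denominator positive when \<open>u = v\<close> and makes the
    displacement strictly shorter than \<open>\<epsilon>\<close>, as the open ball requires.\<close>
  define e where "e = \<epsilon> / (norm (u - v) + 1)"
  have pos: "norm (u - v) + 1 > 0"
    by (simp add: add_nonneg_pos)
  have e: "e > 0"
    using \<epsilon>(1) pos by (simp add: e_def)
  have "e * norm (u - v) < \<epsilon>"
    using \<epsilon>(1) pos by (simp add: e_def pos_divide_less_eq)
  then have "u + e *\<^sub>R (u - v) \<in> ball u \<epsilon>"
    using e by (simp add: dist_norm)
  then have "u + e *\<^sub>R (u - v) \<in> D"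
    using aff_line_mem[OF u assms(2)] \<epsilon>(2) by (meson IntI subsetD)
  with e show ?thesis
    by (rule that)
qed

theorem theorem2p6:
  fixes smulX :: "'k::real_or_complex \<Rightarrow> 'x::real_normed_vector \<Rightarrow> 'x"
    and smulY :: "'k \<Rightarrow> 'y::real_normed_vector \<Rightarrow> 'y"
    and T :: "'x \<Rightarrow> 'y" and F :: "'x set" and u :: 'x
  assumes "normed_space_over smulX" and "normed_space_over smulY"
    and "face_of_unit_ball F"
    and "bounded_operator smulX smulY T"
    and "u \<in> rel_int smulX F"
    and "\<exists>k. k \<noteq> 0 \<and> level_number smulX smulY T k u"
  shows "\<forall>v\<in>F. T v \<noteq> 0"
proof (intro ballI notI)
  fix v assume v: "v \<in> F" and Tv: "T v = 0"
  interpret X: normed_space_over smulX by fact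
  interpret Y: normed_space_over smulY by fact
  obtain k ipX ipY where k: "k \<noteq> 0"
    and ipX: "semi_inner_product smulX ipX" and ipY: "semi_inner_product smulY ipY"
    and level: "\<And>y. ipY (T y) (T u) = k * ipX y u"
    using assms(6) by (auto simp only: level_number_def)
  have unit: "norm x = 1" if "x \<in> F" for x
    using assms(3) that unfolding face_of_unit_ball_def by auto
  have u: "norm u = 1"
    using assms(5) unit unfolding rel_int_def by blast
  \<comment> \<open>Linearity in the first argument, with the zero vector written as a combination
    with zero coefficients.\<close>
  have "ipY 0 (T u) = 0"
    using Y.semi_inner_product_real_combination[OF ipY, of 0 0 0 0] by simp
  \<comment> \<open>The level equation at \<open>v\<close> now reads \<open>0 = k * ipX v u\<close>,
    and \<open>k\<close> is nonzero.\<close>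
  then have vu: "ipX v u = 0"
    using level[of v] k Tv by simp
  obtain e where e: "e > 0" and w: "u + e *\<^sub>R (u - v) \<in> F"
    using X.rel_int_prolong[OF assms(5) v] .
  have "u + e *\<^sub>R (u - v) = (1 + e) *\<^sub>R u + (- e) *\<^sub>R v"
    by (simp add: algebra_simps)
  then have "ipX (u + e *\<^sub>R (u - v)) u = of_real (1 + e)"
    by (simp only: X.semi_inner_product_real_combination[OF ipX] vu)
      (simp add: semi_inner_product_self[OF ipX] u)
  then have "norm (ipX (u + e *\<^sub>R (u - v)) u) = 1 + e"
    using e by (simp only: norm_of_real)
  \<comment> \<open>Both arguments are points of \<open>F\<close>, hence unit vectors, so
    Cauchy-Schwarz gives the bound 1.\<close>
  moreover have "norm (ipX (u + e *\<^sub>R (u - v)) u) \<le> 1"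
    using semi_inner_product_norm_le[OF ipX, of "u + e *\<^sub>R (u - v)" u] unit[OF w] u by simp
  ultimately show False
    using e by simp
qed

end
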